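(* Let $0<\delta<\frac{\pi}{2}$. A convex body $D\subset S^2$ is of constant diameter $\delta$ if and only if it is of constant width $\delta$.
   Context: $S^2$ is the unit sphere in $E^{3}$; $|ab|$ denotes spherical distance (length of the shorter great-circle arc $ab$). A set containing no pair of antipodes is convex if it contains the arc joining any two of its points; a closed convex set with non-empty interior is a convex body. A hemisphere is the intersection of $S^2$ with a closed half-space of $E^{3}$ bounded by a plane through the origin. A hemisphere $H$ supports a convex body $C$ at $p$ if $C\subset H$ and $p\in\mathrm{bd}(H)\cap C$. For different, non-opposite hemispheres $G,H$, the lune $G\cap H$ has thickness equal to the spherical distance between the midpoints of the semicircles $\mathrm{bd}(G)\cap H$ and $\mathrm{bd}(H)\cap G$. For a hemisphere $K$ supporting $C$, $\mathrm{width}_K(C)$ is the thickness of a narrowest lune of the form $K\cap K^*$ containing $C$; $C$ is of constant width $w$ if $\mathrm{width}_K(C)=w$ for every supporting hemisphere $K$ of $C$. A convex body $D$ of diameter $\delta$ is of constant diameter $\delta$ if for every $p\in\mathrm{bd}(D)$ there is $p'\in\mathrm{bd}(D)$ with $|pp'|=\delta$. *)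

theory Defs
  imports "HOL-Analysis.Analysis"
begin

type_synonym pt = "real^3"

definition S2 :: "pt set" where
  "S2 = sphere 0 1"

definition sdist :: "pt \<Rightarrow> pt \<Rightarrow> real" where
  "sdist a b = arccos (a \<bullet> b)"

text \<open>Great-circle arc joining two non-antipodal points of the sphere.\<close>
definition sarc :: "pt \<Rightarrow> pt \<Rightarrow> pt set" where
  "sarc a b = {sgn ((1 - t) *\<^sub>R a + t *\<^sub>R b) | t. 0 \<le> t \<and> t \<le> 1}"

definition sbd :: "pt set \<Rightarrow> pt set" where
  "sbd X = closure X \<inter> closure (S2 - X)"

definition no_antipodes :: "pt set \<Rightarrow> bool" where
  "no_antipodes C \<longleftrightarrow> (\<forall>x\<in>C. - x \<notin> C)"

definition sconvex :: "pt set \<Rightarrow> bool" where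
  "sconvex C \<longleftrightarrow> C \<subseteq> S2 \<and> no_antipodes C \<and> (\<forall>a\<in>C. \<forall>b\<in>C. sarc a b \<subseteq> C)"

definition convex_body :: "pt set \<Rightarrow> bool" where
  "convex_body C \<longleftrightarrow> sconvex C \<and> closed C \<and> (\<exists>x\<in>C. \<exists>e>0. S2 \<inter> ball x e \<subseteq> C)"

definition hemisphere :: "pt set \<Rightarrow> bool" where
  "hemisphere H \<longleftrightarrow> (\<exists>n. n \<noteq> 0 \<and> H = {x \<in> S2. n \<bullet> x \<ge> 0})"

definition opp :: "pt set \<Rightarrow> pt set" where
  "opp H = closure (S2 - H)"

definition supports_at :: "pt set \<Rightarrow> pt set \<Rightarrow> pt \<Rightarrow> bool" where
  "supports_at H C p \<longleftrightarrow> hemisphere H \<and> C \<subseteq> H \<and> p \<in> sbd H \<inter> C"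

definition supporting :: "pt set \<Rightarrow> pt set \<Rightarrow> bool" where
  "supporting H C \<longleftrightarrow> (\<exists>p. supports_at H C p)"

text \<open>Midpoint of a semicircle: the unique point of it within distance pi/2 of all its points.\<close>
definition smid :: "pt set \<Rightarrow> pt" where
  "smid A = (THE m. m \<in> A \<and> (\<forall>x\<in>A. sdist m x \<le> pi / 2))"

text \<open>Thickness of the lune G \<inter> H (G, H different, non-opposite hemispheres).\<close>
definition thickness :: "pt set \<Rightarrow> pt set \<Rightarrow> real" where
  "thickness G H = sdist (smid (sbd G \<inter> H)) (smid (sbd H \<inter> G))"

definition width :: "pt set \<Rightarrow> pt set \<Rightarrow> real" where
  "width K C = Inf {thickness K K' | K'. hemisphere K' \<and> K' \<noteq> K \<and> K' \<noteq> opp K \<and> C \<subseteq> K \<inter> K'}"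

definition constant_width :: "pt set \<Rightarrow> real \<Rightarrow> bool" where
  "constant_width C w \<longleftrightarrow> (\<forall>K. supporting K C \<longrightarrow> width K C = w)"

definition sdiam :: "pt set \<Rightarrow> real" where
  "sdiam D = Sup {sdist x y | x y. x \<in> D \<and> y \<in> D}"

definition constant_diameter :: "pt set \<Rightarrow> real \<Rightarrow> bool" where
  "constant_diameter D d \<longleftrightarrow> convex_body D \<and> sdiam D = d \<and>
     (\<forall>p\<in>sbd D. \<exists>p'\<in>sbd D. sdist p p' = d)"

end

theory Submission
  imports Defs
begin

text \<open>
  Hemispheres containing \<open>D\<close> correspond to the points of the polar body \<open>E\<close>, the set of their unit
  inner normals, and the lune with normals \<open>n\<close>, \<open>m\<close> has thickness \<open>arccos (- (n \<bullet> m))\<close>. Write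
  \<open>c = cos \<delta>\<close> and \<open>s = sin \<delta>\<close>. Constant width \<open>\<delta>\<close> says that on \<open>E\<close> the minimum of \<open>m \<mapsto> n \<bullet> m\<close> is
  \<open>- c\<close> for every \<open>n \<in> E\<close> that is orthogonal to some \<open>p \<in> D\<close>.

  If \<open>D\<close> has constant diameter \<open>\<delta>\<close>, then projecting an outer point to the cone over \<open>D\<close> shows that \<open>D\<close>
  is the intersection of the balls of radius \<open>\<delta>\<close> about its points. Hence a ball of radius \<open>\<delta>\<close> that
  is supported by \<open>n\<close> at \<open>p\<close> contains \<open>D\<close>, so that its centre \<open>c p + s n\<close> belongs to \<open>D\<close>; testing this
  point against \<open>E\<close> gives the lower bound, and \<open>s p - c n \<in> E\<close> attains it.

  Conversely, let \<open>D\<close> have constant width \<open>\<delta>\<close>. A farthest pair \<open>a\<close>, \<open>b\<close> of \<open>D\<close> is orthogonal to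
  a supporting hemisphere at \<open>a\<close>, and the lune of thickness \<open>\<delta>\<close> on that hemisphere forces
  \<open>a \<bullet> b \<ge> c\<close>. If \<open>n\<close> supports \<open>D\<close> at \<open>p\<close> and \<open>n \<bullet> m = - c\<close>, then first-order optimality of \<open>m\<close> gives
  \<open>q = (n + c m) / s \<in> D\<close>, and \<open>p \<bullet> q \<le> c\<close>.
\<close>

section \<open>Polar bodies, inner products and compactness on the sphere\<close>

text \<open>The dual cone of \<open>D\<close> is cut by the sphere, so that minima over normals are
  taken over a compact set.\<close>

definition polar :: "pt set \<Rightarrow> pt set" where
  "polar D = {n \<in> S2. \<forall>x\<in>D. 0 \<le> n \<bullet> x}"

definition hemi :: "pt \<Rightarrow> pt set" where
  "hemi n = {x \<in> S2. 0 \<le> n \<bullet> x}"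

lemma S2_iff_norm: "x \<in> S2 \<longleftrightarrow> norm x = 1"
  by (simp add: S2_def)

lemma S2_dot_self: "x \<in> S2 \<Longrightarrow> x \<bullet> x = 1"
  by (simp add: S2_iff_norm dot_square_norm)

lemma S2_iff_dot: "x \<in> S2 \<longleftrightarrow> x \<bullet> x = 1"
  by (simp add: S2_iff_norm norm_eq_1)

lemma sgn_in_S2: "x \<noteq> 0 \<Longrightarrow> sgn x \<in> S2" for x :: pt
  by (simp add: S2_iff_norm norm_sgn)

lemma uminus_in_S2: "x \<in> S2 \<Longrightarrow> - x \<in> S2"
  by (simp add: S2_iff_norm)

lemma dot_sgn: "n \<bullet> sgn x = (n \<bullet> x) / norm x" for x n :: pt
  by (simp add: sgn_div_norm divide_inverse_commute)

lemma S2_abs_dot_le: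
  assumes "x \<in> S2" "y \<in> S2"
  shows "\<bar>x \<bullet> y\<bar> \<le> 1"
  using Cauchy_Schwarz_ineq2[of x y] assms by (simp add: S2_iff_norm)

lemma S2_dot_le:
  assumes "x \<in> S2" "y \<in> S2"
  shows "x \<bullet> y \<le> 1"
  using S2_abs_dot_le[OF assms] by simp

lemma S2_dot_eq_1:
  assumes "x \<in> S2" "y \<in> S2" "x \<bullet> y = 1"
  shows "x = y"
proof -
  have "(x - y) \<bullet> (x - y) = 0"
    using assms by (simp add: S2_iff_dot inner_diff inner_commute)
  then show ?thesis by simp
qed

lemma S2_dot_less_1:
  assumes "x \<in> S2" "y \<in> S2" "x \<noteq> y"
  shows "x \<bullet> y < 1"
  using S2_dot_le[OF assms(1,2)] S2_dot_eq_1[OF assms(1,2)] assms(3) by fastforce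

text \<open>Removing from \<open>x\<close> its components along the orthonormal pair
  \<open>n\<close>, \<open>p\<close> leaves a vector of nonnegative squared length.\<close>

lemma S2_bessel:
  assumes "x \<in> S2" "n \<in> S2" "p \<in> S2" "n \<bullet> p = 0"
  shows "(x \<bullet> n)\<^sup>2 + (x \<bullet> p)\<^sup>2 \<le> 1"
proof -
  let ?w = "x - (x \<bullet> n) *\<^sub>R n - (x \<bullet> p) *\<^sub>R p"
  have "?w \<bullet> ?w = 1 - (x \<bullet> n)\<^sup>2 - (x \<bullet> p)\<^sup>2"
    using assms
    by (simp add: S2_iff_dot inner_diff inner_commute power2_eq_square algebra_simps)
  then show ?thesis
    using inner_ge_zero[of ?w] by linarith
qed

lemma compact_S2: "compact S2"
  by (simp add: S2_def)

lemma closed_S2: "closed S2"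
  by (simp add: S2_def)

lemma closed_half_S2: "closed {x \<in> S2. k \<le> n \<bullet> x}"
proof -
  have "{x \<in> S2. k \<le> n \<bullet> x} = S2 \<inter> {x. n \<bullet> x \<ge> k}" by auto
  then show ?thesis
    by (simp add: closed_Int closed_S2 closed_halfspace_ge)
qed

lemma compact_polar: "compact (polar D)"
proof -
  have "polar D = S2 \<inter> (\<Inter>x\<in>D. {n. 0 \<le> x \<bullet> n})"
    by (auto simp: polar_def inner_commute)
  moreover have "closed (\<Inter>x\<in>D. {n. 0 \<le> x \<bullet> n})"
    by (intro closed_INT ballI closed_halfspace_ge)
  ultimately show ?thesis
    by (simp add: compact_Int_closed compact_S2)
qed

section \<open>Boundaries and opposites of hemispheres\<close>

lemma tendsto_sgn_perturb:
  assumes "x \<in> S2"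
  shows "((\<lambda>t. sgn (x + t *\<^sub>R v)) \<longlongrightarrow> x) (at_right 0)"
proof -
  have x: "norm x = 1" "x \<noteq> 0" using assms by (auto simp: S2_iff_norm)
  have "((\<lambda>t. sgn (x + t *\<^sub>R v)) \<longlongrightarrow> sgn (x + 0 *\<^sub>R v)) (at_right 0)"
    using x by (intro tendsto_intros) auto
  then show ?thesis using x by (simp add: sgn_div_norm)
qed

lemma closure_perturb:
  assumes "x \<in> S2" "\<And>t. 0 < t \<Longrightarrow> sgn (x + t *\<^sub>R v) \<in> T"
  shows "x \<in> closure T"
proof (rule Lim_in_closed_set[OF closed_closure _ _ tendsto_sgn_perturb[OF assms(1)]])
  show "\<forall>\<^sub>F t in at_right 0. sgn (x + t *\<^sub>R v) \<in> closure T"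
    using assms(2) by (auto intro!: eventually_at_rightI[of 0 1] subsetD[OF closure_subset])
qed simp

text \<open>Moving from \<open>p\<close> against \<open>n\<close> and renormalising gives points of
  the sphere with negative product with \<open>n\<close>; they lie outside \<open>C\<close> and tend
  to \<open>p\<close>.\<close>

lemma touching_closure_compl:
  assumes "C \<subseteq> S2" "p \<in> S2" "n \<noteq> 0" "\<And>y. y \<in> C \<Longrightarrow> 0 \<le> n \<bullet> y" "n \<bullet> p = 0"
  shows "p \<in> closure (S2 - C)"
proof (rule closure_perturb[OF assms(2), of "- n"])
  fix t :: real assume t: "0 < t"
  let ?u = "p + t *\<^sub>R - n"
  have neg: "n \<bullet> ?u < 0" using assms(3,5) t by (simp add: inner_diff_right)
  then have "?u \<noteq> 0" by auto
  then have "n \<bullet> sgn ?u < 0" using neg by (simp add: dot_sgn divide_neg_pos)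
  then show "sgn ?u \<in> S2 - C"
    using assms(4) sgn_in_S2[OF \<open>?u \<noteq> 0\<close>] by fastforce
qed

lemma touching_sbd:
  assumes "C \<subseteq> S2" "p \<in> C" "n \<noteq> 0" "\<And>y. y \<in> C \<Longrightarrow> 0 \<le> n \<bullet> y" "n \<bullet> p = 0"
  shows "p \<in> sbd C"
proof -
  have "p \<in> closure (S2 - C)"
    using assms by (intro touching_closure_compl[of _ _ n]) auto
  then show ?thesis
    using subsetD[OF closure_subset assms(2)] by (simp add: sbd_def)
qed

lemma closure_compl_hemi:
  assumes "n \<noteq> 0"
  shows "closure (S2 - hemi n) = {x \<in> S2. n \<bullet> x \<le> 0}"
proof
  have "closed {x \<in> S2. n \<bullet> x \<le> 0}" using closed_half_S2[of 0 "- n"] by simp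
  then show "closure (S2 - hemi n) \<subseteq> {x \<in> S2. n \<bullet> x \<le> 0}"
    by (intro closure_minimal) (auto simp: hemi_def)
  show "{x \<in> S2. n \<bullet> x \<le> 0} \<subseteq> closure (S2 - hemi n)"
  proof
    fix x assume x: "x \<in> {x \<in> S2. n \<bullet> x \<le> 0}"
    show "x \<in> closure (S2 - hemi n)"
    proof (cases "n \<bullet> x = 0")
      case True
      then show ?thesis
        using x assms by (intro touching_closure_compl[of _ _ n]) (auto simp: hemi_def)
    next
      case False
      then have "x \<in> S2 - hemi n" using x by (auto simp: hemi_def)
      then show ?thesis by (rule subsetD[OF closure_subset])
    qed
  qed
qed

lemma opp_hemi: "n \<noteq> 0 \<Longrightarrow> opp (hemi n) = hemi (- n)"
  by (simp add: opp_def closure_compl_hemi) (simp add: hemi_def)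

lemma sbd_hemi:
  assumes "n \<noteq> 0"
  shows "sbd (hemi n) = {x \<in> S2. n \<bullet> x = 0}"
proof -
  have "closure (hemi n) = hemi n"
    using closed_half_S2[of 0 n] by (simp add: hemi_def)
  then have "sbd (hemi n) = hemi n \<inter> {x \<in> S2. n \<bullet> x \<le> 0}"
    by (simp only: sbd_def closure_compl_hemi[OF assms])
  also have "\<dots> = {x \<in> S2. n \<bullet> x = 0}"
    by (auto simp: hemi_def)
  finally show ?thesis .
qed

lemma hemisphere_iff: "hemisphere H \<longleftrightarrow> (\<exists>n\<in>S2. H = hemi n)"
proof
  assume "hemisphere H"
  then obtain n where n: "n \<noteq> 0" "H = {x \<in> S2. n \<bullet> x \<ge> 0}" by (auto simp: hemisphere_def)
  have "0 \<le> sgn n \<bullet> x \<longleftrightarrow> 0 \<le> n \<bullet> x" for x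
    using n(1) dot_sgn[of x n] by (simp add: inner_commute zero_le_divide_iff)
  then have "H = hemi (sgn n)" using n(2) by (simp add: hemi_def)
  then show "\<exists>n\<in>S2. H = hemi n" using sgn_in_S2[OF n(1)] by blast
next
  assume "\<exists>n\<in>S2. H = hemi n"
  then obtain n where n: "n \<in> S2" "H = hemi n" by blast
  then have "n \<noteq> 0" by (auto simp: S2_iff_dot)
  then show "hemisphere H" using n(2) unfolding hemisphere_def hemi_def by blast
qed

section \<open>Thickness of lunes in terms of normals\<close>

lemma sdist_le_pi_half:
  assumes "x \<in> S2" "y \<in> S2"
  shows "sdist x y \<le> pi / 2 \<longleftrightarrow> 0 \<le> x \<bullet> y"
  using arccos_le_mono[of "x \<bullet> y" 0] S2_abs_dot_le[OF assms] by (simp add: sdist_def)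

lemma S2_abs_dot_less:
  assumes "n \<in> S2" "m \<in> S2" "m \<noteq> n" "m \<noteq> - n"
  shows "\<bar>m \<bullet> n\<bar> < 1"
  using S2_dot_less_1[of m n] S2_dot_less_1[of m "- n"] assms uminus_in_S2[of n] by auto

text \<open>The midpoint is the normalised component \<open>u\<close> of \<open>m\<close> orthogonal
  to \<open>n\<close>: on the great circle of \<open>n\<close>, the products with \<open>m\<close>
  and with \<open>u\<close> have the same sign. Excluding \<open>m = n\<close> and
  \<open>m = - n\<close> keeps the square root positive.\<close>

lemma smid_semicircle:
  assumes "n \<in> S2" "m \<in> S2" "m \<noteq> n" "m \<noteq> - n"
  shows "smid (sbd (hemi n) \<inter> hemi m) = (m - (m \<bullet> n) *\<^sub>R n) /\<^sub>R sqrt (1 - (m \<bullet> n)\<^sup>2)"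
proof -
  define \<kappa> where "\<kappa> = sqrt (1 - (m \<bullet> n)\<^sup>2)"
  define u where "u = (m - (m \<bullet> n) *\<^sub>R n) /\<^sub>R \<kappa>"
  have "(m \<bullet> n)\<^sup>2 < 1"
    using S2_abs_dot_less[OF assms] by (simp add: abs_square_less_1)
  then have \<kappa>: "\<kappa> > 0" "\<kappa>\<^sup>2 = 1 - (m \<bullet> n)\<^sup>2" by (auto simp: \<kappa>_def)
  have nn: "n \<bullet> n = 1" "m \<bullet> m = 1" using assms by (auto simp: S2_iff_dot)
  have m: "m = \<kappa> *\<^sub>R u + (m \<bullet> n) *\<^sub>R n" using \<kappa> by (simp add: u_def)
  have un: "u \<bullet> n = 0" using nn by (simp add: u_def inner_diff)
  have uu: "u \<bullet> u = 1"
  proof -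
    have "(m - (m \<bullet> n) *\<^sub>R n) \<bullet> (m - (m \<bullet> n) *\<^sub>R n) = \<kappa>\<^sup>2"
      using nn by (simp only: \<kappa>(2)) (simp add: inner_diff inner_commute power2_eq_square)
    then show ?thesis using \<kappa>(1) by (simp add: u_def power2_eq_square flip: mult.assoc)
  qed
  have mdot: "m \<bullet> x = \<kappa> * (u \<bullet> x)" if "n \<bullet> x = 0" for x
  proof -
    have "m \<bullet> x = (\<kappa> *\<^sub>R u + (m \<bullet> n) *\<^sub>R n) \<bullet> x" using m by simp
    then show ?thesis using that by (simp add: inner_add_left)
  qed
  let ?A = "{x \<in> S2. n \<bullet> x = 0 \<and> 0 \<le> u \<bullet> x}"
  have "n \<noteq> 0" using nn by auto
  have A: "sbd (hemi n) \<inter> hemi m = ?A"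
    unfolding sbd_hemi[OF \<open>n \<noteq> 0\<close>] using \<kappa>(1) mdot by (auto simp: hemi_def zero_le_mult_iff)
  have uS: "u \<in> S2" using uu by (simp add: S2_iff_dot)
  have "smid ?A = u"
    unfolding smid_def
  proof (rule the_equality)
    show "u \<in> ?A \<and> (\<forall>x\<in>?A. sdist u x \<le> pi / 2)"
      using uu un uS sdist_le_pi_half[OF uS] by (simp add: inner_commute[of n u])
  next
    fix v assume v: "v \<in> ?A \<and> (\<forall>x\<in>?A. sdist v x \<le> pi / 2)"
    then have vS: "v \<in> S2" "n \<bullet> v = 0" "0 \<le> u \<bullet> v" by blast+
    \<comment> \<open>If the part \<open>w\<close> of \<open>v\<close> orthogonal to
      \<open>u\<close> did not vanish, then \<open>sgn (- w)\<close> would be an endpoint of the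
      semicircle at distance more than \<open>pi / 2\<close> from \<open>v\<close>.\<close>
    define w where "w = v - (u \<bullet> v) *\<^sub>R u"
    have w0: "w = 0"
    proof (rule ccontr)
      assume "w \<noteq> 0"
      have uw: "u \<bullet> w = 0" "n \<bullet> w = 0"
        using uu un vS by (auto simp: w_def inner_diff inner_commute)
      have "sgn (- w) \<in> ?A"
        using sgn_in_S2[of "- w"] \<open>w \<noteq> 0\<close> uw by (simp add: dot_sgn)
      then have "0 \<le> v \<bullet> sgn (- w)" using v sdist_le_pi_half vS(1) by blast
      then have "v \<bullet> w \<le> 0" using \<open>w \<noteq> 0\<close> by (simp add: dot_sgn divide_le_0_iff)
      moreover have "v \<bullet> w = w \<bullet> w"
        using uw by (simp add: w_def inner_diff inner_commute)
      ultimately show False using \<open>w \<noteq> 0\<close> inner_gt_zero_iff[of w] by linarith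
    qed
    then have vu: "v = (u \<bullet> v) *\<^sub>R u" by (simp add: w_def)
    have "norm v = \<bar>u \<bullet> v\<bar> * norm u" by (subst vu) simp
    then have "u \<bullet> v = 1" using vS uS by (simp add: S2_iff_norm)
    then show "v = u" using vu by simp
  qed
  then show ?thesis by (simp add: A u_def \<kappa>_def)
qed

text \<open>Each midpoint is one normal with its component along the other removed. The sign is
  negative because the angle of a lune is \<open>pi\<close> minus the angle between its inner
  normals.\<close>

lemma thickness_hemi:
  assumes "n \<in> S2" "m \<in> S2" "m \<noteq> n" "m \<noteq> - n"
  shows "thickness (hemi n) (hemi m) = arccos (- (n \<bullet> m))"
proof -
  let ?c = "m \<bullet> n"
  have c: "?c\<^sup>2 < 1"
    using S2_abs_dot_less[OF assms] by (simp add: abs_square_less_1)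
  have nn: "n \<bullet> n = 1" "m \<bullet> m = 1" using assms by (auto simp: S2_iff_dot)
  have "(m - ?c *\<^sub>R n) \<bullet> (n - ?c *\<^sub>R m) = - ?c * (1 - ?c\<^sup>2)"
    using nn by (simp add: inner_diff inner_commute power2_eq_square algebra_simps)
  moreover have "inverse (sqrt (1 - ?c\<^sup>2)) * inverse (sqrt (1 - ?c\<^sup>2)) = inverse (1 - ?c\<^sup>2)"
    using c by (simp flip: inverse_mult_distrib)
  ultimately have "((m - ?c *\<^sub>R n) /\<^sub>R sqrt (1 - ?c\<^sup>2)) \<bullet> ((n - ?c *\<^sub>R m) /\<^sub>R sqrt (1 - ?c\<^sup>2)) = - ?c"
    using c by (simp add: mult.assoc [symmetric])
  moreover have "smid (sbd (hemi m) \<inter> hemi n) = (n - ?c *\<^sub>R m) /\<^sub>R sqrt (1 - ?c\<^sup>2)"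
    using smid_semicircle[of m n] assms minus_equation_iff[of m n] by (auto simp: inner_commute[of n m])
  ultimately show ?thesis
    using smid_semicircle[OF assms] by (simp add: thickness_def sdist_def inner_commute)
qed

section \<open>Width and supporting hemispheres in terms of normals\<close>

text \<open>For distinct unit normals the direction of \<open>m - n\<close> lies in
  \<open>hemi m\<close> but not in \<open>hemi n\<close>.\<close>

lemma hemi_inj:
  assumes "n \<in> S2" "m \<in> S2" "hemi n = hemi m"
  shows "n = m"
proof (rule ccontr)
  assume "n \<noteq> m"
  then have "n \<bullet> m < 1" using S2_dot_less_1 assms by blast
  have "n \<bullet> (m - n) < 0" "0 < m \<bullet> (m - n)" "m - n \<noteq> 0"
    using \<open>n \<noteq> m\<close> \<open>n \<bullet> m < 1\<close> assms
    by (auto simp: inner_diff_right S2_dot_self inner_commute[of m n])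
  then have "sgn (m - n) \<in> hemi m" "sgn (m - n) \<notin> hemi n"
    using sgn_in_S2[of "m - n"] by (auto simp: hemi_def dot_sgn zero_le_divide_iff)
  then show False using assms(3) by blast
qed

lemma subset_hemi_iff:
  assumes "C \<subseteq> S2" "n \<in> S2"
  shows "C \<subseteq> hemi n \<longleftrightarrow> n \<in> polar C"
  using assms by (auto simp: hemi_def polar_def)

text \<open>Since unit normals determine hemispheres, leaving out \<open>n\<close> and
  \<open>- n\<close> corresponds exactly to leaving out the hemisphere itself and its
  opposite.\<close>

lemma width_hemi:
  assumes "C \<subseteq> S2" "n \<in> polar C"
  shows "width (hemi n) C = Inf ((\<lambda>m. arccos (- (n \<bullet> m))) ` (polar C - {n, - n}))"
proof -
  have n: "n \<in> S2" "n \<noteq> 0" using assms(2) by (auto simp: polar_def S2_iff_norm)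
  have "{thickness (hemi n) K' | K'. hemisphere K' \<and> K' \<noteq> hemi n \<and> K' \<noteq> opp (hemi n)
            \<and> C \<subseteq> hemi n \<inter> K'}
        = {thickness (hemi n) (hemi m) | m. m \<in> polar C - {n, - n}}" (is "?L = ?R")
  proof
    show "?L \<subseteq> ?R"
      using n assms by (fastforce simp: hemisphere_iff opp_hemi subset_hemi_iff)
    show "?R \<subseteq> ?L"
    proof
      fix y assume "y \<in> ?R"
      then obtain m where m: "y = thickness (hemi n) (hemi m)" "m \<in> polar C" "m \<noteq> n" "m \<noteq> - n"
        by blast
      then have "m \<in> S2" by (simp add: polar_def)
      then have "hemisphere (hemi m)" "hemi m \<noteq> hemi n" "hemi m \<noteq> opp (hemi n)"
        "C \<subseteq> hemi n \<inter> hemi m"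
        using m n assms hemi_inj uminus_in_S2[of n]
        by (auto simp: hemisphere_iff opp_hemi subset_hemi_iff)
      then show "y \<in> ?L" using m(1) by blast
    qed
  qed
  also have "\<dots> = (\<lambda>m. arccos (- (n \<bullet> m))) ` (polar C - {n, - n})"
  proof -
    have "thickness (hemi n) (hemi m) = arccos (- (n \<bullet> m))" if "m \<in> polar C - {n, - n}" for m
      using that n by (intro thickness_hemi) (auto simp: polar_def)
    then show ?thesis by (simp only: Setcompr_eq_image cong: image_cong)
  qed
  finally show ?thesis by (simp add: width_def)
qed

lemma supporting_iff:
  assumes "C \<subseteq> S2"
  shows "supporting K C \<longleftrightarrow> (\<exists>n\<in>polar C. K = hemi n \<and> (\<exists>p\<in>C. n \<bullet> p = 0))"
proof
  assume "supporting K C"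
  then obtain p n where "n \<in> S2" "K = hemi n" "C \<subseteq> K" "p \<in> sbd K" "p \<in> C"
    by (auto simp: supporting_def supports_at_def hemisphere_iff)
  moreover from \<open>n \<in> S2\<close> have "n \<noteq> 0" by (auto simp: S2_iff_dot)
  ultimately show "\<exists>n\<in>polar C. K = hemi n \<and> (\<exists>p\<in>C. n \<bullet> p = 0)"
    using assms by (auto simp: sbd_hemi subset_hemi_iff)
next
  assume "\<exists>n\<in>polar C. K = hemi n \<and> (\<exists>p\<in>C. n \<bullet> p = 0)"
  then obtain n p where n: "n \<in> polar C" "K = hemi n" "p \<in> C" "n \<bullet> p = 0" by blast
  then have "n \<in> S2" "n \<noteq> 0" by (auto simp: polar_def S2_iff_dot)
  then have "supports_at K C p"
    using n assms by (auto simp: supports_at_def hemisphere_iff sbd_hemi subset_hemi_iff)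
  then show "supporting K C" by (auto simp: supporting_def)
qed

section \<open>First-order optimality along chords\<close>

text \<open>The coefficient \<open>k\<close> may have either sign: it is \<open>- cos \<delta>\<close> on the polar body.\<close>

lemma first_order:
  fixes a b x :: pt
  assumes b: "b \<in> S2" and ab: "a \<bullet> b = k"
    and ge: "\<And>t. 0 < t \<Longrightarrow> t < 1 \<Longrightarrow>
        k * norm ((1 - t) *\<^sub>R b + t *\<^sub>R x) \<le> a \<bullet> ((1 - t) *\<^sub>R b + t *\<^sub>R x)"
  shows "0 \<le> (a - k *\<^sub>R b) \<bullet> x"
proof -
  define M where "M = (x - b) \<bullet> (x - b)"
  have bb: "b \<bullet> b = 1" using b by (rule S2_dot_self)
  have key: "- (\<bar>k\<bar> * M / 2) * t \<le> (a - k *\<^sub>R b) \<bullet> x" if t: "0 < t" "t < 1" for t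
  proof -
    let ?w = "(1 - t) *\<^sub>R b + t *\<^sub>R x"
    have M0: "0 \<le> M" by (simp add: M_def)
    \<comment> \<open>The norm agrees with its linear part up to \<open>t\<^sup>2 * M / 2\<close>:
      Cauchy-Schwarz with \<open>b\<close> bounds it from below, and 2 r \<le> 1 + r^2 from above.
      The sign of \<open>k\<close> decides which bound is used.\<close>
    have "norm ?w \<ge> b \<bullet> ?w"
      using norm_cauchy_schwarz[of b ?w] b by (simp add: S2_iff_norm)
    then have lower: "norm ?w \<ge> 1 + t * (b \<bullet> x - 1)"
      using bb by (simp add: inner_add_right algebra_simps)
    have "(norm ?w)\<^sup>2 = 1 + 2 * t * (b \<bullet> x - 1) + t\<^sup>2 * M"
      unfolding M_def power2_norm_eq_inner using bb
      by (simp add: inner_add inner_diff inner_commute power2_eq_square algebra_simps)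
    moreover have "2 * norm ?w \<le> 1 + (norm ?w)\<^sup>2"
      using sum_squares_bound[of 1 "norm ?w"] by simp
    ultimately have upper: "norm ?w \<le> 1 + t * (b \<bullet> x - 1) + t\<^sup>2 * M / 2" by argo
    have eq: "a \<bullet> ?w = k + t * (a \<bullet> x - k)"
      using ab by (simp add: inner_add_right algebra_simps)
    have "k * norm ?w \<ge> k * (1 + t * (b \<bullet> x - 1)) - \<bar>k\<bar> * (t\<^sup>2 * M / 2)"
    proof (cases "0 \<le> k")
      case True
      have "0 \<le> \<bar>k\<bar> * (t\<^sup>2 * M / 2)" using M0 by simp
      then show ?thesis using mult_left_mono[OF lower True] by linarith
    next
      case False
      then show ?thesis
        using mult_left_mono_neg[OF upper, of k] by (simp add: algebra_simps)
    qed
    then have "t * (- (\<bar>k\<bar> * M / 2) * t) \<le> t * ((a - k *\<^sub>R b) \<bullet> x)"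
      using ge[OF t] eq by (simp add: inner_diff_left power2_eq_square algebra_simps)
    then show ?thesis using t(1) by (simp only: mult_le_cancel_left_pos)
  qed
  have "((\<lambda>t. - (\<bar>k\<bar> * M / 2) * t) \<longlongrightarrow> - (\<bar>k\<bar> * M / 2) * 0) (at_right 0)"
    by (intro tendsto_intros)
  moreover have "\<forall>\<^sub>F t in at_right 0. - (\<bar>k\<bar> * M / 2) * t \<le> (a - k *\<^sub>R b) \<bullet> x"
    using key by (intro eventually_at_rightI[of 0 1]) auto
  ultimately show ?thesis
    using tendsto_upperbound by fastforce
qed

section \<open>Cones over convex sets, projection and separation\<close>

lemma sconvex_combination:
  assumes "sconvex D" "x \<in> D" "y \<in> D" "0 \<le> a" "0 \<le> b" "a + b > 0"
  shows "sgn (a *\<^sub>R x + b *\<^sub>R y) \<in> D" "a *\<^sub>R x + b *\<^sub>R y \<noteq> 0"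
proof -
  let ?t = "b / (a + b)"
  have "1 - ?t = a / (a + b)" using assms by (simp add: field_simps)
  then have "(1 - ?t) *\<^sub>R x + ?t *\<^sub>R y = (a *\<^sub>R x + b *\<^sub>R y) /\<^sub>R (a + b)"
    by (simp add: scaleR_add_right divide_inverse mult.commute)
  moreover have "sgn ((a *\<^sub>R x + b *\<^sub>R y) /\<^sub>R (a + b)) = sgn (a *\<^sub>R x + b *\<^sub>R y)"
    using assms by (simp add: sgn_scaleR)
  moreover have "sgn ((1 - ?t) *\<^sub>R x + ?t *\<^sub>R y) \<in> sarc x y"
    unfolding sarc_def using assms by (intro CollectI exI[of _ ?t] conjI refl) (auto simp: field_simps)
  ultimately show 1: "sgn (a *\<^sub>R x + b *\<^sub>R y) \<in> D"
    using assms unfolding sconvex_def by (metis subsetD)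
  \<comment> \<open>Since \<open>sgn 0 = 0\<close> is not on the sphere, membership in
    \<open>D\<close> rules out a vanishing combination.\<close>
  then have "sgn (a *\<^sub>R x + b *\<^sub>R y) \<in> S2" using assms(1) by (auto simp: sconvex_def)
  then show "a *\<^sub>R x + b *\<^sub>R y \<noteq> 0" by (auto simp: S2_iff_norm)
qed

lemma convex_conic_hull_sconvex:
  assumes "sconvex D"
  shows "convex (conic hull D)"
proof -
  have sum: "v + w \<in> conic hull D" if vw: "v \<in> conic hull D" "w \<in> conic hull D" for v w
  proof -
    obtain a x b y where *: "0 \<le> a" "x \<in> D" "v = a *\<^sub>R x" "0 \<le> b" "y \<in> D" "w = b *\<^sub>R y"
      using vw by (auto simp: conic_hull_explicit)
    show ?thesis
    proof (cases "a + b > 0")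
      case True
      let ?u = "a *\<^sub>R x + b *\<^sub>R y"
      have "?u = norm ?u *\<^sub>R sgn ?u"
        using sconvex_combination(2)[OF assms *(2,5,1,4) True] by (simp add: sgn_div_norm)
      then show ?thesis
        using sconvex_combination(1)[OF assms *(2,5,1,4) True] *
        unfolding conic_hull_explicit by fastforce
    next
      case False
      then have "v = 0" using * by auto
      then show ?thesis using vw(2) by simp
    qed
  qed
  have "u *\<^sub>R v \<in> conic hull D" if "v \<in> conic hull D" "0 \<le> u" for u v
    using that conic_conic_hull conicD by blast
  then show ?thesis unfolding convex_def using sum by blast
qed

text \<open>Moreau decomposition of \<open>x\<close> with respect to the cone over \<open>D\<close>:
  \<open>r *\<^sub>R p\<close> is the nearest point of the cone. If \<open>r = 0\<close>, this is
  the apex and \<open>p\<close> is an arbitrary point of \<open>D\<close>, hence the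
  disjunction.\<close>

lemma project_cone:
  assumes D: "sconvex D" "closed D" "D \<noteq> {}" and x: "x \<in> S2" "x \<notin> D"
  obtains p n r s where "p \<in> D" "n \<in> polar D" "0 \<le> r" "0 < s" "x = r *\<^sub>R p - s *\<^sub>R n"
    "r = 0 \<or> n \<bullet> p = 0"
proof -
  let ?K = "conic hull D"
  have DS: "D \<subseteq> S2" using D(1) by (simp add: sconvex_def)
  then have "compact D" using D(2) compact_S2 compact_Int_closed[of S2 D] by (simp add: inf_absorb2)
  moreover have "0 \<notin> D" using DS by (auto simp: S2_iff_norm)
  ultimately have K: "closed ?K" "convex ?K" "?K \<noteq> {}"
    using closed_conic_hull[of D] convex_conic_hull_sconvex[OF D(1)] D(3) hull_subset[of D conic]
    by auto
  define q where "q = closest_point ?K x"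
  have qK: "q \<in> ?K" unfolding q_def using closest_point_in_set[OF K(1,3)] .
  then obtain r p where q: "0 \<le> r" "p \<in> D" "q = r *\<^sub>R p" by (auto simp: conic_hull_explicit)
  have pp: "p \<bullet> p = 1" using q DS S2_dot_self by blast
  have xK: "x \<notin> ?K"
  proof
    assume "x \<in> ?K"
    then obtain a y where y: "0 \<le> a" "y \<in> D" "x = a *\<^sub>R y" by (auto simp: conic_hull_explicit)
    then have "norm y = 1" using DS by (auto simp: S2_iff_norm)
    then have "a = 1" using y x(1) by (simp add: S2_iff_norm)
    then show False using y x(2) by simp
  qed
  define v where "v = q - x"
  have v0: "v \<noteq> 0" using xK qK by (auto simp: v_def)
  have dot: "0 \<le> v \<bullet> (y - q)" if "y \<in> ?K" for y
    using closest_point_dot[OF K(2,1) that, of x] by (simp add: v_def q_def[symmetric] inner_diff)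
  \<comment> \<open>Testing the variational inequality at 0 and at twice the nearest point
    \<open>q\<close> gives both signs of \<open>v \<bullet> q\<close>.\<close>
  have "0 \<in> ?K" "2 *\<^sub>R q \<in> ?K" 
    using qK conic_conic_hull[of D] conicD[of ?K q 0] conicD[of ?K q 2] by auto
  from dot[OF this(1)] dot[OF this(2)] have vq: "v \<bullet> q = 0"
    by (simp add: inner_diff_right)
  have "0 \<le> v \<bullet> y" if "y \<in> D" for y
    using dot[of y] vq hull_subset[of D conic] that by (auto simp: inner_diff_right)
  then have "0 \<le> sgn v \<bullet> y" if "y \<in> D" for y
    using that by (simp add: sgn_div_norm zero_le_mult_iff)
  then have "sgn v \<in> polar D" using sgn_in_S2[OF v0] by (simp add: polar_def)
  moreover have "x = r *\<^sub>R p - norm v *\<^sub>R sgn v"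
    using v0 q by (simp add: sgn_div_norm v_def)
  moreover have "r = 0 \<or> sgn v \<bullet> p = 0"
    using vq q by (auto simp: sgn_div_norm)
  ultimately show ?thesis using that q v0 by (metis zero_less_norm_iff)
qed

lemma separate_sconvex:
  assumes "sconvex D" "closed D" "D \<noteq> {}" "x \<in> S2" "x \<notin> D"
  shows "\<exists>n\<in>polar D. n \<bullet> x < 0"
proof -
  obtain p n r s where *: "p \<in> D" "n \<in> polar D" "0 \<le> r" "0 < s" "x = r *\<^sub>R p - s *\<^sub>R n"
    "r = 0 \<or> n \<bullet> p = 0" using project_cone[OF assms] .
  have "n \<bullet> n = 1" using *(2) by (simp add: polar_def S2_dot_self)
  then have "n \<bullet> x = - s" using * by (auto simp: inner_diff_right)
  then show ?thesis using *(2,4) by (intro bexI[of _ n]) auto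
qed

lemma bipolar:
  assumes "sconvex D" "closed D" "D \<noteq> {}" "x \<in> S2" "\<And>n. n \<in> polar D \<Longrightarrow> 0 \<le> n \<bullet> x"
  shows "x \<in> D"
  using separate_sconvex[OF assms(1-4)] assms(5) by fastforce

text \<open>Normals separating outer points that tend to \<open>p\<close> subconverge in the compact
  polar body, and the limit touches \<open>D\<close> at \<open>p\<close>.\<close>

lemma normal_at_boundary:
  assumes D: "sconvex D" "closed D" "D \<noteq> {}" and p: "p \<in> sbd D"
  shows "p \<in> D" "\<exists>n\<in>polar D. n \<bullet> p = 0"
proof -
  show pD: "p \<in> D" using p D(2) by (simp add: sbd_def)
  have "p \<in> closure (S2 - D)" using p by (simp add: sbd_def)
  then obtain X where X: "\<And>i. X i \<in> S2 - D" "X \<longlonglongrightarrow> p"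
    unfolding closure_sequential by blast
  then have "\<exists>n\<in>polar D. n \<bullet> X i < 0" for i
    using separate_sconvex[OF D] by blast
  then obtain N where N: "\<And>i. N i \<in> polar D" "\<And>i. N i \<bullet> X i < 0" by metis
  obtain n f where n: "n \<in> polar D" "strict_mono f" "(N \<circ> f) \<longlonglongrightarrow> n"
    using compact_polar[of D] N(1) unfolding compact_def by blast
  have "(\<lambda>i. (N \<circ> f) i \<bullet> (X \<circ> f) i) \<longlonglongrightarrow> n \<bullet> p"
    using n(3) LIMSEQ_subseq_LIMSEQ[OF X(2) n(2)] by (rule tendsto_inner)
  then have "n \<bullet> p \<le> 0"
    by (rule LIMSEQ_le_const2) (auto intro: less_imp_le N(2))
  moreover have "0 \<le> n \<bullet> p" using n(1) pD by (simp add: polar_def)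
  ultimately show "\<exists>n\<in>polar D. n \<bullet> p = 0" using n(1) by (intro bexI[of _ n]) auto
qed

text \<open>Puts a bound on unit vectors into the homogeneous form that \<open>first_order\<close>
  expects on unnormalised chords.\<close>

lemma scaled_ge_on_cone:
  fixes a w :: pt
  assumes "w \<noteq> 0 \<Longrightarrow> k \<le> a \<bullet> sgn w"
  shows "k * norm w \<le> a \<bullet> w"
  using assms by (cases "w = 0") (auto simp: dot_sgn pos_le_divide_eq)

lemma first_order_sconvex:
  assumes "sconvex D" "b \<in> D" "a \<bullet> b = k" "\<And>y. y \<in> D \<Longrightarrow> k \<le> a \<bullet> y" "x \<in> D"
  shows "0 \<le> (a - k *\<^sub>R b) \<bullet> x"
proof (rule first_order)
  show "b \<in> S2" using assms by (auto simp: sconvex_def)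
  show "k * norm ((1 - t) *\<^sub>R b + t *\<^sub>R x) \<le> a \<bullet> ((1 - t) *\<^sub>R b + t *\<^sub>R x)" if "0 < t" "t < 1" for t
    using that sconvex_combination(1)[OF assms(1,2,5), of "1 - t" t] assms(4)
    by (intro scaled_ge_on_cone) simp
qed (use assms in simp)

lemma first_order_polar:
  assumes "b \<in> polar D" "a \<bullet> b = k" "\<And>y. y \<in> polar D \<Longrightarrow> k \<le> a \<bullet> y" "x \<in> polar D"
  shows "0 \<le> (a - k *\<^sub>R b) \<bullet> x"
proof (rule first_order)
  show "b \<in> S2" using assms by (auto simp: polar_def)
  fix t :: real assume t: "0 < t" "t < 1"
  let ?w = "(1 - t) *\<^sub>R b + t *\<^sub>R x"
  have "0 \<le> ?w \<bullet> y" if "y \<in> D" for y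
    using assms(1,4) that t by (simp add: polar_def inner_add_left)
  then have "sgn ?w \<in> polar D" if "?w \<noteq> 0"
    using sgn_in_S2[OF that] by (simp add: polar_def sgn_div_norm)
  then show "k * norm ?w \<le> a \<bullet> ?w"
    using assms(3) by (intro scaled_ge_on_cone) simp
qed (use assms in simp)

text \<open>Two opposite normals would confine \<open>D\<close> to a great circle, but an interior
  point can be moved towards \<open>n\<close> inside \<open>D\<close>.\<close>

lemma polar_no_antipodes:
  assumes "convex_body D" "n \<in> polar D"
  shows "- n \<notin> polar D"
proof
  assume neg: "- n \<in> polar D"
  obtain x e where x: "x \<in> D" "0 < e" "S2 \<inter> ball x e \<subseteq> D"
    using assms(1) by (auto simp: convex_body_def)
  have xS: "x \<in> S2" using assms(1) x(1) by (auto simp: convex_body_def sconvex_def)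
  have nS: "n \<bullet> n = 1" using assms(2) by (simp add: polar_def S2_dot_self)
  have zero: "n \<bullet> y = 0" if "y \<in> D" for y
    using assms(2) neg that by (fastforce simp: polar_def)
  have "\<forall>\<^sub>F t in at_right 0. dist (sgn (x + t *\<^sub>R n)) x < e"
    using tendstoD[OF tendsto_sgn_perturb[OF xS] x(2)] .
  then obtain d where d: "0 < d" "\<And>t. 0 < t \<Longrightarrow> t < d \<Longrightarrow> dist (sgn (x + t *\<^sub>R n)) x < e"
    by (auto simp: eventually_at_right_field)
  let ?u = "x + (d / 2) *\<^sub>R n"
  have pos: "0 < n \<bullet> ?u" using d nS zero[OF x(1)] by (simp add: inner_add_right)
  then have u0: "?u \<noteq> 0" by auto
  have "sgn ?u \<in> D"
    using x(3) sgn_in_S2[OF u0] d(2)[of "d / 2"] d(1) by (auto simp: dist_commute)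
  then have "n \<bullet> sgn ?u = 0" by (rule zero)
  then show False using pos u0 by (simp add: dot_sgn)
qed

section \<open>From constant diameter to constant width\<close>

text \<open>Project an outer \<open>x\<close> to \<open>r *\<^sub>R p\<close>. Then
  \<open>r \<noteq> 0\<close>, since otherwise \<open>x \<bullet> p \<le> 0 < c\<close>, so
  \<open>p\<close> is a boundary point. Its diametral partner \<open>q\<close> yields
  \<open>c \<le> r * c\<close>, whereas \<open>r\<^sup>2 + t\<^sup>2 = 1\<close> with
  \<open>t > 0\<close> forces \<open>r < 1\<close>.\<close>

lemma complete_of_diametral_boundary:
  assumes D: "sconvex D" "closed D" "D \<noteq> {}" and c: "0 < c"
    and diametral: "\<And>p. p \<in> sbd D \<Longrightarrow> \<exists>q\<in>D. p \<bullet> q = c"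
    and x: "x \<in> S2" "\<And>y. y \<in> D \<Longrightarrow> c \<le> x \<bullet> y"
  shows "x \<in> D"
proof (rule ccontr)
  assume "x \<notin> D"
  then obtain p n r t where *: "p \<in> D" "n \<in> polar D" "0 \<le> r" "0 < t" "x = r *\<^sub>R p - t *\<^sub>R n"
    "r = 0 \<or> n \<bullet> p = 0"
    using project_cone[OF D x(1)] by blast
  have DS: "D \<subseteq> S2" using D(1) by (simp add: sconvex_def)
  have nS: "n \<in> S2" and npos: "\<And>y. y \<in> D \<Longrightarrow> 0 \<le> n \<bullet> y"
    using *(2) by (auto simp: polar_def)
  have pS: "p \<in> S2" using DS *(1) by blast
  have "r \<noteq> 0"
  proof
    assume "r = 0"
    then have "x \<bullet> p = - t * (n \<bullet> p)" using * by simp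
    then show False using x(2)[OF *(1)] mult_nonneg_nonneg[OF less_imp_le[OF *(4)] npos[OF *(1)]] c by linarith
  qed
  then have np: "n \<bullet> p = 0" using * by simp
  have "n \<noteq> 0" using nS by (auto simp: S2_iff_norm)
  then have "p \<in> sbd D" using touching_sbd[OF DS *(1) _ npos np] by blast
  then obtain q where q: "q \<in> D" "p \<bullet> q = c" using diametral by blast
  have "x \<bullet> q = r * c - t * (n \<bullet> q)" using *(5) q by (simp add: inner_diff_left)
  then have "c \<le> r * c"
    using x(2)[OF q(1)] mult_nonneg_nonneg[OF less_imp_le[OF *(4)] npos[OF q(1)]] by linarith
  then have "1 \<le> r" using c by simp
  moreover have "x \<bullet> x = r\<^sup>2 + t\<^sup>2"
    using np nS pS *(5) by (simp add: S2_iff_dot inner_diff inner_commute power2_eq_square)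
  then have "r\<^sup>2 + t\<^sup>2 = 1" using x(1) by (simp add: S2_iff_dot)
  ultimately show False
    using *(4) one_le_power[of r 2] zero_less_power[of t 2] by linarith
qed

lemma S2_dot_le_of_orthogonal:
  assumes "x \<in> S2" "n \<in> S2" "p \<in> S2" "n \<bullet> p = 0" "c\<^sup>2 + s\<^sup>2 = 1" "0 \<le> s"
    and "c\<^sup>2 \<le> (x \<bullet> p)\<^sup>2"
  shows "x \<bullet> n \<le> s"
proof -
  have "(x \<bullet> n)\<^sup>2 \<le> s\<^sup>2" using S2_bessel[OF assms(1-4)] assms(5,7) by linarith
  then show ?thesis using assms(6) by (rule power2_le_imp_le)
qed

text \<open>By completeness it suffices that \<open>D\<close> lies in the ball about the proposed
  centre. A point \<open>x\<close> of \<open>D\<close> outside this ball would allow a small move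
  from \<open>p\<close> out of the hemisphere \<open>n\<close> that stays in all balls about points
  of \<open>D\<close>, hence in \<open>D\<close>.\<close>

lemma ball_rolls:
  assumes DS: "D \<subseteq> S2"
    and complete: "\<And>x. x \<in> S2 \<Longrightarrow> (\<And>y. y \<in> D \<Longrightarrow> c \<le> x \<bullet> y) \<Longrightarrow> x \<in> D"
    and diam: "\<And>x y. x \<in> D \<Longrightarrow> y \<in> D \<Longrightarrow> c \<le> x \<bullet> y"
    and c: "0 < c" "0 < s" "c\<^sup>2 + s\<^sup>2 = 1"
    and n: "n \<in> polar D" and p: "p \<in> D" and np: "n \<bullet> p = 0"
  shows "c *\<^sub>R p + s *\<^sub>R n \<in> D"
proof (rule complete)
  have nS: "n \<in> S2" "n \<bullet> n = 1" using n by (auto simp: polar_def S2_dot_self)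
  have pS: "p \<in> S2" "p \<bullet> p = 1" using p DS by (auto simp: S2_dot_self)
  show "c *\<^sub>R p + s *\<^sub>R n \<in> S2"
    using nS pS np c(3) by (simp add: S2_iff_dot inner_add inner_commute power2_eq_square)
  fix x assume x: "x \<in> D"
  then have xS: "x \<in> S2" using DS by blast
  show "c \<le> (c *\<^sub>R p + s *\<^sub>R n) \<bullet> x"
  proof (rule ccontr)
    assume "\<not> ?thesis"
    then have "s * (n \<bullet> x) < c * (1 - x \<bullet> p)"
      by (simp add: inner_add_left inner_commute algebra_simps)
    then have "n \<bullet> x < c * (1 - x \<bullet> p) / s" using c by (simp add: field_simps)
    then obtain \<beta> where \<beta>: "n \<bullet> x < \<beta>" "\<beta> < c * (1 - x \<bullet> p) / s" using dense by blast
    \<comment> \<open>The tangent direction \<open>v\<close> at \<open>p\<close> points strictly out of the hemisphere \<open>n\<close>, but with a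
      margin \<open>\<eta>\<close> into every ball of radius \<open>arccos c\<close> about a point of \<open>D\<close>.\<close>
    define \<eta> where "\<eta> = c * (1 - x \<bullet> p) - \<beta> * s"
    have \<eta>: "0 < \<eta>" using \<beta>(2) c by (simp add: \<eta>_def field_simps)
    have "0 \<le> n \<bullet> x" using n x by (simp add: polar_def)
    then have \<beta>0: "0 < \<beta>" using \<beta>(1) by simp
    define v where "v = x - (x \<bullet> p) *\<^sub>R p - \<beta> *\<^sub>R n"
    have nv: "n \<bullet> v < 0" using np nS \<beta>(1) by (simp add: v_def inner_diff_right)
    have vp: "v \<bullet> p = 0" using np pS by (simp add: v_def inner_diff_left)
    define M where "M = v \<bullet> v"
    have M: "0 < M" using nv by (auto simp: M_def)
    \<comment> \<open>With this \<open>t\<close> the second-order growth of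
      \<open>c * norm ?w\<close> is at most half of the gain \<open>t * \<eta>\<close>. The cap 1
      ensures \<open>t * (x \<bullet> p) \<le> 1\<close>.\<close>
    define t where "t = min 1 (\<eta> / (c * M))"
    have t: "0 < t" "t \<le> 1" "t * (c * M) \<le> \<eta>"
    proof -
      show "0 < t" "t \<le> 1" using \<eta> c M by (auto simp: t_def)
      have "t \<le> \<eta> / (c * M)" by (simp add: t_def)
      then show "t * (c * M) \<le> \<eta>" using c M by (simp add: pos_le_divide_eq)
    qed
    let ?w = "p + t *\<^sub>R v"
    have nw: "n \<bullet> ?w < 0" using np nv t by (simp add: inner_add_right mult_pos_neg)
    then have w0: "?w \<noteq> 0" by auto
    have "(norm ?w)\<^sup>2 = 1 + t\<^sup>2 * M"
      unfolding power2_norm_eq_inner using pS vp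
      by (simp add: M_def inner_add inner_commute power2_eq_square)
    moreover have "2 * norm ?w \<le> 1 + (norm ?w)\<^sup>2"
      using sum_squares_bound[of 1 "norm ?w"] by simp
    ultimately have "norm ?w \<le> 1 + t\<^sup>2 * M / 2" by argo
    then have "c * norm ?w \<le> c * (1 + t\<^sup>2 * M / 2)" using c by simp
    also have "\<dots> = c + t * (t * (c * M)) / 2" by (simp add: power2_eq_square algebra_simps)
    also have "\<dots> \<le> c + t * \<eta>"
      using mult_left_mono[OF t(3), of t] t(1) \<eta> mult_pos_pos[OF t(1) \<eta>] by linarith
    finally have norm_w: "c * norm ?w \<le> c + t * \<eta>" .
    have "c \<le> sgn ?w \<bullet> y" if y: "y \<in> D" for y
    proof -
      have yS: "y \<in> S2" using y DS by blast
      have e: "0 \<le> y \<bullet> p - c" using diam[OF y p] by simp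
      have "y \<bullet> n \<le> s"
        using e c by (intro S2_dot_le_of_orthogonal[OF yS nS(1) pS(1) np c(3)]) auto
      then have "\<beta> * (y \<bullet> n) \<le> \<beta> * s" using \<beta>0 by simp
      moreover have "c \<le> y \<bullet> x" using diam[OF y x] .
      moreover have "y \<bullet> v = y \<bullet> x - (x \<bullet> p) * (y \<bullet> p) - \<beta> * (y \<bullet> n)"
        by (simp add: v_def inner_diff_right)
      moreover have "\<eta> - (x \<bullet> p) * (y \<bullet> p - c) = c - (x \<bullet> p) * (y \<bullet> p) - \<beta> * s"
        by (simp add: \<eta>_def algebra_simps)
      \<comment> \<open>The loss is proportional to the slack \<open>y \<bullet> p - c\<close>;
        after scaling by \<open>t\<close> it is at most this slack, which
        \<open>y \<bullet> p\<close> itself supplies.\<close>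
      ultimately have "\<eta> - (x \<bullet> p) * (y \<bullet> p - c) \<le> y \<bullet> v" by linarith
      from mult_left_mono[OF this, of t] t(1)
      have "t * \<eta> - (t * (x \<bullet> p)) * (y \<bullet> p - c) \<le> t * (y \<bullet> v)" by (simp add: algebra_simps)
      moreover have "t * (x \<bullet> p) \<le> 1"
        using t S2_dot_le[OF xS pS(1)] mult_left_mono[of "x \<bullet> p" 1 t] by linarith
      then have "(t * (x \<bullet> p)) * (y \<bullet> p - c) \<le> y \<bullet> p - c"
        using mult_right_mono[OF _ e] by fastforce
      ultimately have "c + t * \<eta> \<le> y \<bullet> ?w" by (simp add: inner_add_right)
      then have "c * norm ?w \<le> y \<bullet> ?w" using norm_w by linarith
      then show ?thesis using w0 by (simp add: inner_commute[of _ y] dot_sgn pos_le_divide_eq)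
    qed
    then have "sgn ?w \<in> D" using complete[OF sgn_in_S2[OF w0]] by blast
    then have "0 \<le> n \<bullet> sgn ?w" using n by (simp add: polar_def)
    then show False using nw w0 by (simp add: dot_sgn zero_le_divide_iff)
  qed
qed

text \<open>The centre \<open>c *\<^sub>R p + s *\<^sub>R n\<close> is a point of \<open>D\<close>
  opposite to \<open>p\<close>; it bounds every lune on \<open>hemi n\<close> from below, and the
  hemisphere touching there attains the bound.\<close>

lemma width_of_ball_rolls:
  assumes DS: "D \<subseteq> S2"
    and diam: "\<And>x y. x \<in> D \<Longrightarrow> y \<in> D \<Longrightarrow> c \<le> x \<bullet> y"
    and c: "0 < c" "0 < s" "c\<^sup>2 + s\<^sup>2 = 1"
    and n: "n \<in> polar D" and p: "p \<in> D" and np: "n \<bullet> p = 0"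
    and z: "c *\<^sub>R p + s *\<^sub>R n \<in> D"
  shows "width (hemi n) D = arccos c"
proof -
  have nS: "n \<in> S2" "n \<bullet> n = 1" using n by (auto simp: polar_def S2_dot_self)
  have pS: "p \<in> S2" "p \<bullet> p = 1" using p DS by (auto simp: S2_dot_self)
  have c1: "c < 1"
  proof (rule power2_less_imp_less)
    show "c\<^sup>2 < 1\<^sup>2" using c(3) zero_less_power[OF c(2), of 2] by (simp only: one_power2)
  qed simp
  \<comment> \<open>This unit vector is orthogonal to \<open>c *\<^sub>R p + s *\<^sub>R n\<close>.
    It is nonnegative on \<open>D\<close> because there \<open>x \<bullet> p \<ge> c\<close> and
    \<open>x \<bullet> n \<le> s\<close>.\<close>
  define m where "m = s *\<^sub>R p - c *\<^sub>R n"
  have "m \<in> S2"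
    using nS pS np c(3) by (simp add: m_def S2_iff_dot inner_diff inner_commute power2_eq_square)
  moreover have "0 \<le> m \<bullet> x" if x: "x \<in> D" for x
  proof -
    have xp: "c \<le> x \<bullet> p" using diam[OF x p] .
    have "x \<bullet> n \<le> s"
      using xp c x DS by (intro S2_dot_le_of_orthogonal[OF _ nS(1) pS(1) np c(3)]) auto
    moreover have "0 \<le> x \<bullet> n" using n x by (simp add: polar_def inner_commute[of x n])
    ultimately have "c * (x \<bullet> n) \<le> s * (x \<bullet> p)"
      using mult_mono'[of c "x \<bullet> p" "x \<bullet> n" s] xp c by (simp add: mult.commute)
    then show ?thesis by (simp add: m_def inner_diff_left inner_commute[of x])
  qed
  ultimately have mP: "m \<in> polar D" by (simp add: polar_def)
  have nm: "n \<bullet> m = - c" using np nS by (simp add: m_def inner_diff_right)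
  then have "m \<noteq> n" "m \<noteq> - n" using nS c c1 by auto
  then have "arccos c \<in> (\<lambda>m. arccos (- (n \<bullet> m))) ` (polar D - {n, - n})"
    using mP nm by (intro image_eqI[of _ _ m]) auto
  moreover have "arccos c \<le> arccos (- (n \<bullet> l))" if l: "l \<in> polar D" for l
  proof -
    have lS: "l \<in> S2" using l by (simp add: polar_def)
    have "- (n \<bullet> l) \<le> c"
    \<comment> \<open>For small \<open>l \<bullet> p\<close> the test point in \<open>D\<close>
      gives the bound; for large \<open>l \<bullet> p\<close> Bessel's inequality alone
      does.\<close>
    proof (cases "l \<bullet> p \<le> s")
      case True
      have "0 \<le> l \<bullet> (c *\<^sub>R p + s *\<^sub>R n)" using l z by (simp add: polar_def)
      then have "s * (- (n \<bullet> l)) \<le> c * (l \<bullet> p)"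
        by (simp add: inner_add_right inner_commute)
      also have "\<dots> \<le> s * c" using True c by simp
      finally show ?thesis using mult_left_le_imp_le[OF _ c(2)] by blast
    next
      case False
      then have "s\<^sup>2 \<le> (l \<bullet> p)\<^sup>2" using c by (intro power_mono) auto
      then show ?thesis
        using S2_dot_le_of_orthogonal[of l "- n" p s c] lS nS pS np c uminus_in_S2[OF nS(1)]
        by (simp add: inner_commute add.commute)
    qed
    then show ?thesis
      using arccos_le_mono[of c "- (n \<bullet> l)"] S2_abs_dot_le[OF nS(1) lS] c c1 by simp
  qed
  ultimately show ?thesis
    unfolding width_hemi[OF DS n] by (intro cInf_eq_minimum) auto
qed

section \<open>From constant width to constant diameter\<close>

text \<open>The minimum of \<open>n \<bullet> m\<close> over the polar body is attained, and the
  minimiser is neither \<open>n\<close> nor \<open>- n\<close>, so it also attains the infimum that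
  defines the width.\<close>

lemma polar_opposite_of_width:
  assumes D: "convex_body D" and n: "n \<in> polar D" and p: "p \<in> D" "n \<bullet> p = 0"
    and w: "width (hemi n) D = arccos c" and c: "0 < c" "c < 1"
  shows "\<exists>m\<in>polar D. n \<bullet> m = - c \<and> (\<forall>l\<in>polar D. - c \<le> n \<bullet> l)"
proof -
  have D': "sconvex D" "closed D" "D \<noteq> {}" "D \<subseteq> S2"
    using D by (auto simp: convex_body_def sconvex_def)
  have nS: "n \<in> S2" using n by (simp add: polar_def)
  have "continuous_on (polar D) (\<lambda>m. n \<bullet> m)" by (intro continuous_intros)
  then obtain m where m: "m \<in> polar D" "\<And>l. l \<in> polar D \<Longrightarrow> n \<bullet> m \<le> n \<bullet> l"
    using continuous_attains_inf[OF compact_polar] n by (metis empty_iff)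
  have mS: "m \<in> S2" using m by (simp add: polar_def)
  \<comment> \<open>A normal separating \<open>- p\<close> from \<open>D\<close> is positive at
    \<open>p\<close>, hence differs from \<open>n\<close>; so \<open>n\<close> is not the
    minimiser.\<close>
  have "- p \<in> S2" "- p \<notin> D"
    using p D' D by (auto simp: uminus_in_S2 convex_body_def sconvex_def no_antipodes_def)
  then obtain l where l: "l \<in> polar D" "l \<bullet> (- p) < 0"
    using separate_sconvex[OF D'(1-3)] by blast
  then have "l \<noteq> n" "l \<in> S2" using p by (auto simp: polar_def)
  then have "n \<bullet> m < 1" using m(2)[OF l(1)] S2_dot_less_1[OF nS] by fastforce
  then have "m \<noteq> n" using nS by (auto simp: S2_dot_self)
  moreover have "m \<noteq> - n" using polar_no_antipodes[OF D n] m(1) by blast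
  ultimately have "arccos (- (n \<bullet> m)) \<in> (\<lambda>m. arccos (- (n \<bullet> m))) ` (polar D - {n, - n})"
    using m(1) by blast
  moreover have "arccos (- (n \<bullet> m)) \<le> arccos (- (n \<bullet> k))" if "k \<in> polar D" for k
    using arccos_le_mono[of "- (n \<bullet> m)" "- (n \<bullet> k)"] m(2)[OF that] S2_abs_dot_le[OF nS mS]
      S2_abs_dot_le[OF nS, of k] that by (simp add: polar_def)
  ultimately have "width (hemi n) D = arccos (- (n \<bullet> m))"
    unfolding width_hemi[OF D'(4) n] by (intro cInf_eq_minimum) auto
  then have "cos (arccos (- (n \<bullet> m))) = cos (arccos c)" using w by simp
  then have "n \<bullet> m = - c"
    using S2_abs_dot_le[OF nS mS] c by (simp add: cos_arccos_abs)
  then show ?thesis using m by auto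
qed

text \<open>Minimise \<open>x \<bullet> y\<close> over \<open>D \<times> D\<close>. First-order
  optimality of \<open>a\<close> for fixed \<open>b\<close> makes \<open>b - k *\<^sub>R a\<close> a
  normal at \<open>a\<close>; \<open>n\<close> and \<open>\<sigma>\<close> are its direction and
  length.\<close>

lemma farthest_pair:
  assumes D: "convex_body D"
  obtains a b n \<sigma> k where "a \<in> D" "b \<in> D" "n \<in> polar D" "n \<bullet> a = 0" "0 < \<sigma>"
    "k\<^sup>2 + \<sigma>\<^sup>2 = 1" "b = k *\<^sub>R a + \<sigma> *\<^sub>R n" "\<forall>x\<in>D. \<forall>y\<in>D. k \<le> x \<bullet> y"
proof -
  have D': "sconvex D" "closed D" "D \<noteq> {}" "D \<subseteq> S2"
    using D by (auto simp: convex_body_def sconvex_def)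
  have "compact D" using D' compact_S2 compact_Int_closed[of S2 D] by (simp add: inf_absorb2)
  then have "compact (D \<times> D)" by (simp add: compact_Times)
  moreover have "continuous_on (D \<times> D) (\<lambda>z. fst z \<bullet> snd z)" by (intro continuous_intros)
  moreover have "D \<times> D \<noteq> {}" using D'(3) by simp
  ultimately obtain z where z: "z \<in> D \<times> D" "\<And>y. y \<in> D \<times> D \<Longrightarrow> fst z \<bullet> snd z \<le> fst y \<bullet> snd y"
    using continuous_attains_inf[of "D \<times> D" "\<lambda>z. fst z \<bullet> snd z"] by blast
  define a b k where "a = fst z" and "b = snd z" and "k = a \<bullet> b"
  have ab: "a \<in> D" "b \<in> D" using z(1) by (auto simp: a_def b_def)
  have k: "k \<le> x \<bullet> y" if "x \<in> D" "y \<in> D" for x y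
    using z(2)[of "(x, y)"] that by (simp add: k_def a_def b_def)
  have abS: "a \<in> S2" "b \<in> S2" using ab D' by auto
  \<comment> \<open>Otherwise \<open>D\<close> is a single point, and any direction orthogonal to it
    gives two opposite normals.\<close>
  have "a \<noteq> b"
  proof
    assume "a = b"
    then have "k = 1" using abS by (simp add: k_def S2_dot_self)
    then have single: "x = a" if "x \<in> D" for x
      using k[OF that ab(1)] S2_dot_le[of x a] S2_dot_eq_1[of x a] that ab D' by force
    obtain v where v: "v \<noteq> 0" "orthogonal a v"
      using orthogonal_to_vector_exists[of a] by auto
    have "sgn v \<bullet> x = 0" if "x \<in> D" for x
      using single[OF that] v by (simp add: sgn_div_norm orthogonal_def inner_commute)
    then have "sgn v \<in> polar D" "- sgn v \<in> polar D"
      using sgn_in_S2[OF v(1)] uminus_in_S2[OF sgn_in_S2[OF v(1)]] by (auto simp: polar_def)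
    then show False using polar_no_antipodes[OF D] by blast
  qed
  have aa: "a \<bullet> a = 1" "b \<bullet> b = 1" using abS by (auto simp: S2_dot_self)
  let ?v = "b - k *\<^sub>R a"
  have v0: "?v \<noteq> 0"
  proof
    assume "?v = 0"
    then have "b = k *\<^sub>R a" by simp
    then have "\<bar>k\<bar> = 1" using abS by (simp add: S2_iff_norm)
    then have "b = a \<or> b = - a" using \<open>b = k *\<^sub>R a\<close> by (auto simp: abs_if split: if_splits)
    then show False
      using \<open>a \<noteq> b\<close> ab D' by (auto simp: sconvex_def no_antipodes_def)
  qed
  have "0 \<le> ?v \<bullet> x" if "x \<in> D" for x
    using first_order_sconvex[OF D'(1) ab(1), of b k x] k ab that by (simp add: k_def inner_commute)
  then have "sgn ?v \<in> polar D"
    using sgn_in_S2[OF v0] by (simp add: polar_def sgn_div_norm)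
  moreover have "sgn ?v \<bullet> a = 0"
    using aa by (simp add: sgn_div_norm inner_diff_left k_def inner_commute[of b a])
  moreover have "b = k *\<^sub>R a + norm ?v *\<^sub>R sgn ?v"
    using v0 by (simp add: sgn_div_norm)
  moreover have "k\<^sup>2 + (norm ?v)\<^sup>2 = 1"
    unfolding power2_norm_eq_inner using aa
    by (simp add: inner_diff k_def inner_commute power2_eq_square)
  ultimately show ?thesis using that[of a b "sgn ?v" "norm ?v" k] ab v0 k by auto
qed

text \<open>Testing the opposite normal \<open>m\<close> at \<open>b\<close>, with
  \<open>m \<bullet> a \<le> s\<close>, gives \<open>\<sigma> * c \<le> k * s\<close>: the tangent
  of the largest distance is at most \<open>s / c\<close>.\<close>

lemma diameter_le_of_polar_opposite:
  assumes D: "convex_body D" and c: "0 < c" "0 < s" "c\<^sup>2 + s\<^sup>2 = 1"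
    and opposite: "\<And>n p. n \<in> polar D \<Longrightarrow> p \<in> D \<Longrightarrow> n \<bullet> p = 0 \<Longrightarrow> \<exists>m\<in>polar D. n \<bullet> m = - c"
    and xy: "x \<in> D" "y \<in> D"
  shows "c \<le> x \<bullet> y"
proof -
  have DS: "D \<subseteq> S2" using D by (auto simp: convex_body_def sconvex_def)
  obtain a b n \<sigma> k where *: "a \<in> D" "b \<in> D" "n \<in> polar D" "n \<bullet> a = 0" "0 < \<sigma>"
    "k\<^sup>2 + \<sigma>\<^sup>2 = 1" "b = k *\<^sub>R a + \<sigma> *\<^sub>R n" "\<forall>x\<in>D. \<forall>y\<in>D. k \<le> x \<bullet> y"
    by (rule farthest_pair[OF D])
  obtain m where m: "m \<in> polar D" "n \<bullet> m = - c" using opposite *(1,3,4) by blast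
  have "0 \<le> m \<bullet> b" "0 \<le> m \<bullet> a" using m(1) *(1,2) by (auto simp: polar_def)
  moreover have "m \<bullet> b = k * (m \<bullet> a) - \<sigma> * c"
    using *(7) m(2) by (simp add: inner_add_right inner_commute)
  ultimately have le: "\<sigma> * c \<le> k * (m \<bullet> a)" "0 \<le> m \<bullet> a" by auto
  \<comment> \<open>Positivity of \<open>k\<close> excludes distances of \<open>pi / 2\<close> or
    more and permits squaring.\<close>
  have pos: "0 < \<sigma> * c" using * c by simp
  then have "0 < k * (m \<bullet> a)" using le by linarith
  then have k0: "0 < k" using le(2) by (simp add: zero_less_mult_iff)
  have "m \<bullet> a \<le> s"
    using S2_dot_le_of_orthogonal[of m a n c s] m * c DS
    by (auto simp: polar_def inner_commute)
  then have "\<sigma> * c \<le> k * s" using le(1) mult_left_mono[of "m \<bullet> a" s k] k0 by linarith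
  then have "(\<sigma> * c)\<^sup>2 \<le> (k * s)\<^sup>2" using pos by (intro power_mono) auto
  moreover have "\<sigma>\<^sup>2 = 1 - k\<^sup>2" "s\<^sup>2 = 1 - c\<^sup>2" using *(6) c(3) by auto
  ultimately have "c\<^sup>2 \<le> k\<^sup>2" by (simp add: power_mult_distrib algebra_simps)
  then have "c \<le> k" using less_imp_le[OF k0] by (rule power2_le_imp_le)
  then show ?thesis using bspec[OF bspec[OF *(8) xy(1)] xy(2)] by linarith
qed

text \<open>Optimality of \<open>m\<close> and the bipolar property put \<open>q\<close> into
  \<open>D\<close>. Bessel's inequality gives \<open>p \<bullet> q \<le> c\<close>, and the diameter
  bound gives equality.\<close>

lemma diametral_point_of_polar_opposite:
  assumes D: "convex_body D" and c: "0 < c" "0 < s" "c\<^sup>2 + s\<^sup>2 = 1"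
    and diam: "\<And>x y. x \<in> D \<Longrightarrow> y \<in> D \<Longrightarrow> c \<le> x \<bullet> y"
    and n: "n \<in> polar D" and p: "p \<in> D" "n \<bullet> p = 0"
    and m: "m \<in> polar D" "n \<bullet> m = - c" "\<And>l. l \<in> polar D \<Longrightarrow> - c \<le> n \<bullet> l"
  shows "\<exists>q\<in>sbd D. p \<bullet> q = c"
proof -
  have D': "sconvex D" "closed D" "D \<noteq> {}" "D \<subseteq> S2"
    using D by (auto simp: convex_body_def sconvex_def)
  have S: "n \<in> S2" "m \<in> S2" "p \<in> S2" using n m p D' by (auto simp: polar_def)
  \<comment> \<open>This is the midpoint of the semicircle that bounds the lune along the great
    circle of \<open>m\<close>.\<close>
  define q where "q = (n + c *\<^sub>R m) /\<^sub>R s"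
  have "(n + c *\<^sub>R m) \<bullet> (n + c *\<^sub>R m) = 1 - c\<^sup>2"
    using S m(2) by (simp add: inner_add inner_commute S2_dot_self power2_eq_square algebra_simps)
  also have "\<dots> = s * s" using c(3) by (simp add: power2_eq_square)
  finally have qS: "q \<in> S2" using c by (simp add: q_def S2_iff_dot flip: mult.assoc)
  have "0 \<le> l \<bullet> q" if "l \<in> polar D" for l
    using first_order_polar[OF m(1,2) m(3) that] c
    by (simp add: q_def inner_commute[of l] zero_le_mult_iff)
  then have qD: "q \<in> D" using bipolar[OF D'(1-3) qS] by blast
  have "m \<bullet> p \<le> s"
    using S2_dot_le_of_orthogonal[of m p n c s] S m p c by (simp add: inner_commute)
  then have "c * (m \<bullet> p) \<le> c * s" using c by simp
  moreover have "p \<bullet> q = c * (m \<bullet> p) / s"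
    using p by (simp add: q_def inner_add_right inner_commute divide_inverse_commute)
  ultimately have "p \<bullet> q \<le> c" using c by (simp add: pos_divide_le_eq)
  then have pq: "p \<bullet> q = c" using diam[OF p(1) qD] by simp
  \<comment> \<open>Since \<open>q\<close> minimises the product with \<open>p\<close> over
    \<open>D\<close>, optimality turns \<open>p - c *\<^sub>R q\<close> into a normal at
    \<open>q\<close>, which places \<open>q\<close> on the boundary.\<close>
  have "0 \<le> (p - c *\<^sub>R q) \<bullet> x" if "x \<in> D" for x
    using first_order_sconvex[OF D'(1) qD pq diam[OF p(1)] that] .
  moreover have "(p - c *\<^sub>R q) \<bullet> q = 0" using pq qS by (simp add: inner_diff_left S2_dot_self)
  moreover have "(p - c *\<^sub>R q) \<bullet> p = s\<^sup>2"
    using pq S c(3) by (simp add: inner_diff_left S2_dot_self inner_commute[of q p] power2_eq_square)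
  then have "p - c *\<^sub>R q \<noteq> 0" using c by auto
  ultimately have "q \<in> sbd D" using touching_sbd[OF D'(4) qD] by blast
  then show ?thesis using pq by blast
qed

section \<open>Both implications in terms of inner products\<close>

theorem theorem2:
  fixes D :: "(real^3) set" and \<delta> :: real
  assumes "0 < \<delta>" and "\<delta> < pi / 2" and "convex_body D"
  shows "constant_diameter D \<delta> \<longleftrightarrow> constant_width D \<delta>"
proof -
  define c s where "c = cos \<delta>" and "s = sin \<delta>"
  have c: "0 < c" "0 < s" "c\<^sup>2 + s\<^sup>2 = 1" "c < 1" and \<delta>: "\<delta> = arccos c"
    using assms cos_gt_zero_pi[of \<delta>] sin_gt_zero[of \<delta>] cos_monotone_0_pi[of 0 \<delta>]
    by (auto simp: c_def s_def arccos_cos)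
  have D: "sconvex D" "closed D" "D \<noteq> {}" "D \<subseteq> S2"
    using assms(3) by (auto simp: convex_body_def sconvex_def)
  have sdist_le: "sdist x y \<le> \<delta> \<longleftrightarrow> c \<le> x \<bullet> y" and sdist_eq: "sdist x y = \<delta> \<longleftrightarrow> x \<bullet> y = c"
    and sdist_pi: "sdist x y \<le> pi"
    if "x \<in> D" "y \<in> D" for x y
  proof -
    have "\<bar>x \<bullet> y\<bar> \<le> 1" using that D(4) S2_abs_dot_le by blast
    then show "sdist x y \<le> \<delta> \<longleftrightarrow> c \<le> x \<bullet> y" "sdist x y = \<delta> \<longleftrightarrow> x \<bullet> y = c" "sdist x y \<le> pi"
      using c arccos_le_mono[of "x \<bullet> y" c] arccos_eq_iff[of "x \<bullet> y" c] arccos_ubound[of "x \<bullet> y"]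
      by (auto simp: sdist_def \<delta>)
  qed
  show ?thesis
  proof
    assume cd: "constant_diameter D \<delta>"
    have diam: "c \<le> x \<bullet> y" if "x \<in> D" "y \<in> D" for x y
    proof -
      have "sdist x y \<le> sdiam D"
        \<comment> \<open>A real supremum dominates its members only for a set bounded above, here
          by \<open>pi\<close>.\<close>
        unfolding sdiam_def using that sdist_pi by (intro cSup_upper bdd_aboveI[of _ pi]) auto
      then show ?thesis using cd that sdist_le by (simp add: constant_diameter_def)
    qed
    have sbdD: "sbd D \<subseteq> D" using D(2) by (auto simp: sbd_def)
    have "\<exists>q\<in>D. p \<bullet> q = c" if "p \<in> sbd D" for p
      using cd that sbdD sdist_eq unfolding constant_diameter_def by blast
    note complete = complete_of_diametral_boundary[OF D(1-3) c(1) this]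
    show "constant_width D \<delta>"
      unfolding constant_width_def supporting_iff[OF D(4)] \<delta>
      using width_of_ball_rolls[OF D(4) diam c(1-3)] ball_rolls[OF D(4) complete diam c(1-3)]
      by blast
  next
    assume cw: "constant_width D \<delta>"
    have opposite: "\<exists>m\<in>polar D. n \<bullet> m = - c \<and> (\<forall>l\<in>polar D. - c \<le> n \<bullet> l)"
      if "n \<in> polar D" "p \<in> D" "n \<bullet> p = 0" for n p
    proof (rule polar_opposite_of_width[OF assms(3) that _ c(1,4)])
      show "width (hemi n) D = arccos c"
        using cw that unfolding constant_width_def supporting_iff[OF D(4)] \<delta> by blast
    qed
    have diam: "c \<le> x \<bullet> y" if "x \<in> D" "y \<in> D" for x y
      using diameter_le_of_polar_opposite[OF assms(3) c(1-3) _ that] opposite by blast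
    have sbdD: "sbd D \<subseteq> D" using D(2) by (auto simp: sbd_def)
    have diametral: "\<exists>q\<in>sbd D. sdist p q = \<delta>" if n: "n \<in> polar D" "p \<in> D" "n \<bullet> p = 0" for n p
    proof -
      obtain m where m: "m \<in> polar D" "n \<bullet> m = - c" "\<And>l. l \<in> polar D \<Longrightarrow> - c \<le> n \<bullet> l"
        using opposite[OF n] by blast
      show ?thesis
        using diametral_point_of_polar_opposite[OF assms(3) c(1-3) diam n m] sdist_eq n(2) sbdD
        by blast
    qed
    have "\<exists>q\<in>sbd D. sdist p q = \<delta>" if "p \<in> sbd D" for p
      using normal_at_boundary[OF D(1-3) that] diametral by blast
    moreover have "sdiam D = \<delta>"
      unfolding sdiam_def
    proof (rule cSup_eq_maximum)
      \<comment> \<open>Any point with a supporting normal serves; \<open>diametral\<close> then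
        supplies a partner at distance \<open>\<delta>\<close>.\<close>
      obtain a n where "a \<in> D" "n \<in> polar D" "n \<bullet> a = 0"
        by (rule farthest_pair[OF assms(3)])
      then show "\<delta> \<in> {sdist x y | x y. x \<in> D \<and> y \<in> D}"
        using diametral sbdD by blast
    qed (use diam sdist_le in blast)
    ultimately show "constant_diameter D \<delta>"
      using assms(3) by (simp add: constant_diameter_def)
  qed
qed

end
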